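(* Let the terminal object of $\mathcal X$ be a generator of $\mathcal X$. If $\mathcal A$ and $\mathcal B$ are reflective subcategories of $\mathcal X$, then $\mathcal A$ and $\mathcal B$ induce the same regular closure operators (up to isomorphism; i.e. $c_{\mathcal A}(m)\cong c_{\mathcal B}(m)$ for all $m\in\mathcal M$) if and only if $\mathcal B\subseteq S(\mathcal A)$.
   Context: Subcategories are always full and isomorphism-closed. $\mathcal X$ is a category with a fixed class $\mathcal M$ of morphisms containing all isomorphisms. $\mathcal X$ is $\mathcal M$-complete: $\mathcal M$ is closed under composition; pullbacks of $\mathcal M$-morphisms exist and belong to $\mathcal M$; multiple pullbacks of (possibly large) families of $\mathcal M$-morphisms with common codomain exist and belong to $\mathcal M$. Consequently every morphism in $\mathcal M$ is a monomorphism, and for each object $X$ the class $\mathcal M/X$ of $\mathcal M$-morphisms with codomain $X$ is a (possibly large) complete preordered class ($m\le n$ iff $m = n\cdot k$ for some $k$); $\cong$ denotes equivalence in this preorder. Moreover $\mathcal X$ has equalizers, cokernel pairs and finite products, and $\mathcal M$ contains all regular monomorphisms of $\mathcal X$. For a subcategory $\mathcal A$, a morphism is an $\mathcal A$-regular monomorphism if it is the equalizer of two morphisms $h,k : Y\to A$ with $A\in\mathcal A$. The regular closure operator induced by $\mathcal A$ is $c_{\mathcal A}(m)=\bigwedge\{r\in\mathcal M \mid r\ge m,\ r \text{ is } \mathcal A\text{-regular}\}$ for $m \in \mathcal M/X$ (meet in $\mathcal M/X$). $S(\mathcal A)=\{X\in\mathcal X\mid \text{there is a monomorphism } X\to A \text{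 with } A\in\mathcal A\}$.
   Formalization: The printed "if" direction fails (Set, A = all sets, B = one-point sets), so the condition B ⊆ S(A) is replaced by "B ⊆ S(A) and A ⊆ S(B)"; the printed equivalence with B ⊆ S(A) alone is stated for the case A ⊆ B. *)

theory Defs
  imports Main
begin

text \<open>
  A category is a record over a type of objects and a type of arrows; its object class and its
  arrow class are arbitrary subsets of these types, so nothing is assumed about size.
  Composition is written in applicative order: \<open>g \<cdot>\<^bsub>C\<^esub> f\<close> is ``first \<open>f\<close>, then \<open>g\<close>''.
\<close>

record ('o, 'm) cat =
  Obj :: "'o set"
  Mor :: "'m set"
  Dom :: "'m \<Rightarrow> 'o"
  Cod :: "'m \<Rightarrow> 'o"
  Ident :: "'o \<Rightarrow> 'm"
  Comp :: "'m \<Rightarrow> 'm \<Rightarrow> 'm" (infixl "\<cdot>\<index>" 70)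

definition hom :: "('o, 'm) cat \<Rightarrow> 'o \<Rightarrow> 'o \<Rightarrow> 'm set" where
  "hom C a b = {f \<in> Mor C. Dom C f = a \<and> Cod C f = b}"

locale category =
  fixes C :: "('o, 'm) cat" (structure)
  assumes Dom_in: "f \<in> Mor C \<Longrightarrow> Dom C f \<in> Obj C"
    and Cod_in: "f \<in> Mor C \<Longrightarrow> Cod C f \<in> Obj C"
    and Ident_in: "a \<in> Obj C \<Longrightarrow> Ident C a \<in> hom C a a"
    and Comp_in: "f \<in> hom C a b \<Longrightarrow> g \<in> hom C b c \<Longrightarrow> g \<cdot> f \<in> hom C a c"
    and Comp_Ident_right: "f \<in> hom C a b \<Longrightarrow> f \<cdot> Ident C a = f"
    and Comp_Ident_left: "f \<in> hom C a b \<Longrightarrow> Ident C b \<cdot> f = f"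
    and Comp_assoc: "f \<in> hom C a b \<Longrightarrow> g \<in> hom C b c \<Longrightarrow> h \<in> hom C c d \<Longrightarrow>
      (h \<cdot> g) \<cdot> f = h \<cdot> (g \<cdot> f)"

definition is_iso :: "('o, 'm) cat \<Rightarrow> 'm \<Rightarrow> bool" where
  "is_iso C f \<longleftrightarrow> f \<in> Mor C \<and>
    (\<exists>g \<in> hom C (Cod C f) (Dom C f).
      g \<cdot>\<^bsub>C\<^esub> f = Ident C (Dom C f) \<and> f \<cdot>\<^bsub>C\<^esub> g = Ident C (Cod C f))"

definition is_mono :: "('o, 'm) cat \<Rightarrow> 'm \<Rightarrow> bool" where
  "is_mono C f \<longleftrightarrow> f \<in> Mor C \<and>
    (\<forall>Z. \<forall>u \<in> hom C Z (Dom C f). \<forall>v \<in> hom C Z (Dom C f).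
      f \<cdot>\<^bsub>C\<^esub> u = f \<cdot>\<^bsub>C\<^esub> v \<longrightarrow> u = v)"

definition is_terminal :: "('o, 'm) cat \<Rightarrow> 'o \<Rightarrow> bool" where
  "is_terminal C T \<longleftrightarrow> T \<in> Obj C \<and> (\<forall>Z \<in> Obj C. \<exists>!u. u \<in> hom C Z T)"

definition is_generator :: "('o, 'm) cat \<Rightarrow> 'o \<Rightarrow> bool" where
  "is_generator C G \<longleftrightarrow> G \<in> Obj C \<and>
    (\<forall>Y Z. \<forall>f \<in> hom C Y Z. \<forall>g \<in> hom C Y Z.
      f \<noteq> g \<longrightarrow> (\<exists>x \<in> hom C G Y. f \<cdot>\<^bsub>C\<^esub> x \<noteq> g \<cdot>\<^bsub>C\<^esub> x))"

definition is_equalizer :: "('o, 'm) cat \<Rightarrow> 'm \<Rightarrow> 'm \<Rightarrow> 'm \<Rightarrow> bool" where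
  "is_equalizer C h k e \<longleftrightarrow>
    h \<in> Mor C \<and> k \<in> hom C (Dom C h) (Cod C h) \<and>
    e \<in> Mor C \<and> Cod C e = Dom C h \<and> h \<cdot>\<^bsub>C\<^esub> e = k \<cdot>\<^bsub>C\<^esub> e \<and>
    (\<forall>Z. \<forall>u \<in> hom C Z (Dom C h). h \<cdot>\<^bsub>C\<^esub> u = k \<cdot>\<^bsub>C\<^esub> u \<longrightarrow>
      (\<exists>!v. v \<in> hom C Z (Dom C e) \<and> e \<cdot>\<^bsub>C\<^esub> v = u))"

definition is_regular_mono :: "('o, 'm) cat \<Rightarrow> 'm \<Rightarrow> bool" where
  "is_regular_mono C e \<longleftrightarrow> (\<exists>h k. is_equalizer C h k e)"

text \<open>The cokernel pair \<open>(i, j)\<close> of \<open>f\<close> is the pushout of \<open>f\<close> along itself.\<close>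

definition is_cokernel_pair :: "('o, 'm) cat \<Rightarrow> 'm \<Rightarrow> 'm \<Rightarrow> 'm \<Rightarrow> bool" where
  "is_cokernel_pair C f i j \<longleftrightarrow>
    f \<in> Mor C \<and> i \<in> Mor C \<and> Dom C i = Cod C f \<and> j \<in> hom C (Cod C f) (Cod C i) \<and>
    i \<cdot>\<^bsub>C\<^esub> f = j \<cdot>\<^bsub>C\<^esub> f \<and>
    (\<forall>Z. \<forall>u \<in> hom C (Cod C f) Z. \<forall>v \<in> hom C (Cod C f) Z.
      u \<cdot>\<^bsub>C\<^esub> f = v \<cdot>\<^bsub>C\<^esub> f \<longrightarrow>
      (\<exists>!w. w \<in> hom C (Cod C i) Z \<and> w \<cdot>\<^bsub>C\<^esub> i = u \<and> w \<cdot>\<^bsub>C\<^esub> j = v))"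

definition is_product :: "('o, 'm) cat \<Rightarrow> 'i set \<Rightarrow> ('i \<Rightarrow> 'o) \<Rightarrow> 'o \<Rightarrow> ('i \<Rightarrow> 'm) \<Rightarrow> bool" where
  "is_product C I F P pr \<longleftrightarrow>
    P \<in> Obj C \<and> (\<forall>i \<in> I. pr i \<in> hom C P (F i)) \<and>
    (\<forall>Z \<in> Obj C. \<forall>q. (\<forall>i \<in> I. q i \<in> hom C Z (F i)) \<longrightarrow>
      (\<exists>!u. u \<in> hom C Z P \<and> (\<forall>i \<in> I. pr i \<cdot>\<^bsub>C\<^esub> u = q i)))"

text \<open>\<open>m'\<close> is the pullback of \<open>m\<close> along \<open>f\<close>; \<open>f'\<close> is the other leg: \<open>m \<cdot> f' = f \<cdot> m'\<close>.\<close>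

definition is_pullback :: "('o, 'm) cat \<Rightarrow> 'm \<Rightarrow> 'm \<Rightarrow> 'm \<Rightarrow> 'm \<Rightarrow> bool" where
  "is_pullback C m f m' f' \<longleftrightarrow>
    m \<in> Mor C \<and> f \<in> Mor C \<and> Cod C f = Cod C m \<and>
    m' \<in> Mor C \<and> Cod C m' = Dom C f \<and> f' \<in> hom C (Dom C m') (Dom C m) \<and>
    m \<cdot>\<^bsub>C\<^esub> f' = f \<cdot>\<^bsub>C\<^esub> m' \<and>
    (\<forall>Z. \<forall>u \<in> hom C Z (Dom C f). \<forall>v \<in> hom C Z (Dom C m).
      m \<cdot>\<^bsub>C\<^esub> v = f \<cdot>\<^bsub>C\<^esub> u \<longrightarrow>
      (\<exists>!w. w \<in> hom C Z (Dom C m') \<and> m' \<cdot>\<^bsub>C\<^esub> w = u \<and> f' \<cdot>\<^bsub>C\<^esub> w = v))"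

text \<open>
  \<open>p\<close> is the diagonal of the multiple pullback of the family \<open>(m i)\<close>, \<open>i \<in> I\<close>, of arrows with
  codomain \<open>X\<close>, with projections \<open>\<pi> i\<close>. For empty \<open>I\<close> this says that \<open>p\<close> is an isomorphism.
\<close>

definition is_multiple_pullback ::
  "('o, 'm) cat \<Rightarrow> 'o \<Rightarrow> 'i set \<Rightarrow> ('i \<Rightarrow> 'm) \<Rightarrow> 'm \<Rightarrow> ('i \<Rightarrow> 'm) \<Rightarrow> bool" where
  "is_multiple_pullback C X I m p \<pi> \<longleftrightarrow>
    (\<forall>i \<in> I. m i \<in> Mor C \<and> Cod C (m i) = X) \<and>
    p \<in> Mor C \<and> Cod C p = X \<and>
    (\<forall>i \<in> I. \<pi> i \<in> hom C (Dom C p) (Dom C (m i)) \<and> m i \<cdot>\<^bsub>C\<^esub> \<pi> i = p) \<and>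
    (\<forall>Z. \<forall>q \<in> hom C Z X. \<forall>\<sigma>.
      (\<forall>i \<in> I. \<sigma> i \<in> hom C Z (Dom C (m i)) \<and> m i \<cdot>\<^bsub>C\<^esub> \<sigma> i = q) \<longrightarrow>
      (\<exists>!u. u \<in> hom C Z (Dom C p) \<and> p \<cdot>\<^bsub>C\<^esub> u = q \<and> (\<forall>i \<in> I. \<pi> i \<cdot>\<^bsub>C\<^esub> u = \<sigma> i)))"

text \<open>
  Large families are indexed by arbitrary sets over the arrow type. This loses no generality:
  taking as many copies of a single \<open>m\<close> in \<open>\<M>\<close> as there are arrows already forces \<open>m\<close> to be a
  monomorphism (a Cantor argument), and the multiple pullback of a family of monomorphisms
  depends only on its set of members.
\<close>

locale M_complete_category = category C for C :: "('o, 'm) cat" (structure) +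
  fixes \<M> :: "'m set"
  assumes M_Mor: "\<M> \<subseteq> Mor C"
    and M_iso: "is_iso C f \<Longrightarrow> f \<in> \<M>"
    and M_Comp: "m \<in> \<M> \<Longrightarrow> n \<in> \<M> \<Longrightarrow> Cod C m = Dom C n \<Longrightarrow> n \<cdot> m \<in> \<M>"
    and M_pullback_ex: "m \<in> \<M> \<Longrightarrow> f \<in> Mor C \<Longrightarrow> Cod C f = Cod C m \<Longrightarrow>
      \<exists>m' f'. is_pullback C m f m' f'"
    and M_pullback: "m \<in> \<M> \<Longrightarrow> is_pullback C m f m' f' \<Longrightarrow> m' \<in> \<M>"
    and M_multiple_pullback_ex: "\<And>(I :: 'm set) m X. X \<in> Obj C \<Longrightarrow>
      (\<And>i. i \<in> I \<Longrightarrow> m i \<in> \<M> \<and> Cod C (m i) = X) \<Longrightarrow>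
      \<exists>p \<pi>. is_multiple_pullback C X I m p \<pi>"
    and M_multiple_pullback: "\<And>(I :: 'm set) m X p \<pi>. (\<And>i. i \<in> I \<Longrightarrow> m i \<in> \<M>) \<Longrightarrow>
      is_multiple_pullback C X I m p \<pi> \<Longrightarrow> p \<in> \<M>"

locale regular_closure_setting = M_complete_category +
  assumes has_equalizers: "f \<in> hom C a b \<Longrightarrow> g \<in> hom C a b \<Longrightarrow> \<exists>e. is_equalizer C f g e"
    and has_cokernel_pairs: "f \<in> Mor C \<Longrightarrow> \<exists>i j. is_cokernel_pair C f i j"
    and has_finite_products: "\<And>(I :: nat set) F. finite I \<Longrightarrow> (\<And>i. i \<in> I \<Longrightarrow> F i \<in> Obj C) \<Longrightarrow>
      \<exists>P pr. is_product C I F P pr"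
    and M_regular_mono: "is_regular_mono C e \<Longrightarrow> e \<in> \<M>"

text \<open>The preorder on arrows with common codomain and its induced equivalence.\<close>

definition sub_le :: "('o, 'm) cat \<Rightarrow> 'm \<Rightarrow> 'm \<Rightarrow> bool" where
  "sub_le C m n \<longleftrightarrow> (\<exists>k \<in> hom C (Dom C m) (Dom C n). m = n \<cdot>\<^bsub>C\<^esub> k)"

definition sub_equiv :: "('o, 'm) cat \<Rightarrow> 'm \<Rightarrow> 'm \<Rightarrow> bool" where
  "sub_equiv C m n \<longleftrightarrow> sub_le C m n \<and> sub_le C n m"

definition M_over :: "('o, 'm) cat \<Rightarrow> 'm set \<Rightarrow> 'o \<Rightarrow> 'm set" where
  "M_over C \<M> X = {m \<in> \<M>. Cod C m = X}"

definition is_meet :: "('o, 'm) cat \<Rightarrow> 'm set \<Rightarrow> 'o \<Rightarrow> 'm set \<Rightarrow> 'm \<Rightarrow> bool" where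
  "is_meet C \<M> X R c \<longleftrightarrow>
    c \<in> M_over C \<M> X \<and> (\<forall>r \<in> R. sub_le C c r) \<and>
    (\<forall>n \<in> M_over C \<M> X. (\<forall>r \<in> R. sub_le C n r) \<longrightarrow> sub_le C n c)"

text \<open>A subcategory is full and isomorphism-closed, hence given by its class of objects.\<close>

definition subcategory :: "('o, 'm) cat \<Rightarrow> 'o set \<Rightarrow> bool" where
  "subcategory C \<A> \<longleftrightarrow> \<A> \<subseteq> Obj C \<and>
    (\<forall>f. is_iso C f \<longrightarrow> Dom C f \<in> \<A> \<longrightarrow> Cod C f \<in> \<A>)"

definition reflective_subcategory :: "('o, 'm) cat \<Rightarrow> 'o set \<Rightarrow> bool" where
  "reflective_subcategory C \<A> \<longleftrightarrow> subcategory C \<A> \<and>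
    (\<forall>X \<in> Obj C. \<exists>R \<in> \<A>. \<exists>\<rho> \<in> hom C X R.
      \<forall>A \<in> \<A>. \<forall>f \<in> hom C X A. \<exists>!g. g \<in> hom C R A \<and> g \<cdot>\<^bsub>C\<^esub> \<rho> = f)"

definition is_A_regular_mono :: "('o, 'm) cat \<Rightarrow> 'o set \<Rightarrow> 'm \<Rightarrow> bool" where
  "is_A_regular_mono C \<A> e \<longleftrightarrow> (\<exists>h k. Cod C h \<in> \<A> \<and> is_equalizer C h k e)"

text \<open>
  The meet in \<open>\<M>/X\<close> exists and is unique only up to \<^const>\<open>sub_equiv\<close>; the closure picks one.
\<close>

definition regular_closure :: "('o, 'm) cat \<Rightarrow> 'm set \<Rightarrow> 'o set \<Rightarrow> 'm \<Rightarrow> 'm" where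
  "regular_closure C \<M> \<A> m =
    (SOME c. is_meet C \<M> (Cod C m) {r \<in> \<M>. sub_le C m r \<and> is_A_regular_mono C \<A> r} c)"

definition same_regular_closure :: "('o, 'm) cat \<Rightarrow> 'm set \<Rightarrow> 'o set \<Rightarrow> 'o set \<Rightarrow> bool" where
  "same_regular_closure C \<M> \<A> \<B> \<longleftrightarrow>
    (\<forall>m \<in> \<M>. sub_equiv C (regular_closure C \<M> \<A> m) (regular_closure C \<M> \<B> m))"

definition S_hull :: "('o, 'm) cat \<Rightarrow> 'o set \<Rightarrow> 'o set" where
  "S_hull C \<A> = {X \<in> Obj C. \<exists>A \<in> \<A>. \<exists>f \<in> hom C X A. is_mono C f}"

end

theory Submission
  imports Defs
begin

text \<open>
  Both directions rest on comparing the classes of \<open>\<A>\<close>-regular and \<open>\<B>\<close>-regular monomorphisms.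

  If \<open>\<B> \<subseteq> S(\<A>)\<close>, then every \<open>\<B>\<close>-regular monomorphism is \<open>\<A>\<close>-regular, because composing the pair
  \<open>h, k : Y \<rightarrow> B\<close> with a monomorphism \<open>B \<rightarrow> A\<close> does not change its equalizer. With the symmetric
  inclusion, the two closures are meets of the same class
  (\<open>A_regular_mono_if_subset_S_hull\<close>).

  Conversely, suppose that the closures agree, let \<open>B \<in> \<B>\<close> and let \<open>\<rho> : B \<rightarrow> R\<close> be its reflection in
  \<open>\<A>\<close>. As the terminal object is a generator, \<open>\<rho>\<close> is a monomorphism as soon as it separates points
  (\<open>mono_if_inj_on_points\<close>). A point \<open>a\<close> of \<open>B\<close> is the equalizer of the identity and the constant
  endomorphism with value \<open>a\<close>, so it is \<open>\<B>\<close>-regular and hence \<open>\<B>\<close>-closed; by hypothesis it is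
  \<open>\<A>\<close>-closed too. But all morphisms from \<open>B\<close> to \<open>\<A>\<close> factor through \<open>\<rho>\<close>, so a point \<open>b\<close> with
  \<open>\<rho> \<cdot> b = \<rho> \<cdot> a\<close> lies in every \<open>\<A>\<close>-regular subobject that contains \<open>a\<close>, hence in the \<open>\<A>\<close>-closure
  of \<open>a\<close> (\<open>point_le_closure\<close>), which is \<open>a\<close> itself. This forces \<open>b = a\<close>, because the only
  endomorphism of the terminal object is the identity, so \<open>B \<in> S(\<A>)\<close>.
\<close>

section \<open>Equalizers and subobjects\<close>

context category
begin

lemma hom_Obj: "f \<in> hom C a b \<Longrightarrow> a \<in> Obj C \<and> b \<in> Obj C"
  using Dom_in Cod_in by (auto simp: hom_def)

lemma hom_Mor: "f \<in> Mor C \<Longrightarrow> f \<in> hom C (Dom C f) (Cod C f)"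
  by (simp add: hom_def)

lemma sub_le_refl: "m \<in> Mor C \<Longrightarrow> sub_le C m m"
  unfolding sub_le_def using Comp_Ident_right[OF hom_Mor] Dom_in Ident_in by metis

lemma sub_le_trans:
  assumes "sub_le C l m" "sub_le C m n" "n \<in> Mor C"
  shows "sub_le C l n"
proof -
  obtain i j where i: "i \<in> hom C (Dom C l) (Dom C m)" "l = m \<cdot> i"
    and j: "j \<in> hom C (Dom C m) (Dom C n)" "m = n \<cdot> j"
    using assms(1,2) unfolding sub_le_def by blast
  have "l = n \<cdot> (j \<cdot> i)"
    using Comp_assoc[OF i(1) j(1) hom_Mor[OF assms(3)]] i(2) j(2) by simp
  then show ?thesis
    using Comp_in[OF i(1) j(1)] unfolding sub_le_def by blast
qed

lemma sub_le_if_equalizes: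
  assumes "is_equalizer C h k r" "u \<in> Mor C" "Cod C u = Dom C h" "h \<cdot> u = k \<cdot> u"
  shows "sub_le C u r"
proof -
  have "u \<in> hom C (Dom C u) (Dom C h)"
    using assms by (simp add: hom_def)
  then have "\<exists>!v. v \<in> hom C (Dom C u) (Dom C r) \<and> r \<cdot> v = u"
    using assms(1,4) unfolding is_equalizer_def by simp
  then show ?thesis
    unfolding sub_le_def by blast
qed

lemma is_mono_Ident:
  assumes "a \<in> Obj C"
  shows "is_mono C (Ident C a)"
proof -
  have "Ident C a \<in> Mor C" "Dom C (Ident C a) = a"
    using Ident_in[OF assms] by (auto simp: hom_def)
  then show ?thesis
    unfolding is_mono_def by (simp add: Comp_Ident_left)
qed

lemma subset_S_hull: "\<A> \<subseteq> \<B> \<Longrightarrow> \<B> \<subseteq> Obj C \<Longrightarrow> \<A> \<subseteq> S_hull C \<B>"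
  unfolding S_hull_def using Ident_in is_mono_Ident by blast

lemma is_equalizer_mono_Comp:
  assumes e: "is_equalizer C h k e" and f: "is_mono C f" "Dom C f = Cod C h"
  shows "is_equalizer C (f \<cdot> h) (f \<cdot> k) e"
proof -
  let ?Y = "Dom C h" and ?B = "Cod C h"
  have h: "h \<in> hom C ?Y ?B" and k: "k \<in> hom C ?Y ?B"
    and eM: "e \<in> hom C (Dom C e) ?Y" and eq: "h \<cdot> e = k \<cdot> e"
    and univ: "\<And>Z u. u \<in> hom C Z ?Y \<Longrightarrow> h \<cdot> u = k \<cdot> u \<Longrightarrow>
      \<exists>!v. v \<in> hom C Z (Dom C e) \<and> e \<cdot> v = u"
    using e unfolding is_equalizer_def hom_def by auto
  have fM: "f \<in> hom C ?B (Cod C f)"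
    using f unfolding is_mono_def hom_def by auto
  have fh: "f \<cdot> h \<in> hom C ?Y (Cod C f)" and fk: "f \<cdot> k \<in> hom C ?Y (Cod C f)"
    using Comp_in[OF h fM] Comp_in[OF k fM] by auto
  have D: "Dom C (f \<cdot> h) = ?Y" "Cod C (f \<cdot> h) = Cod C f"
    using fh by (auto simp: hom_def)
  have cancel: "h \<cdot> u = k \<cdot> u" if u: "u \<in> hom C Z ?Y" and *: "(f \<cdot> h) \<cdot> u = (f \<cdot> k) \<cdot> u" for Z u
  proof -
    have "f \<cdot> (h \<cdot> u) = f \<cdot> (k \<cdot> u)"
      using * Comp_assoc[OF u h fM] Comp_assoc[OF u k fM] by simp
    then show ?thesis
      using f(1) Comp_in[OF u h] Comp_in[OF u k] unfolding is_mono_def f(2) by blast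
  qed
  have "(f \<cdot> h) \<cdot> e = (f \<cdot> k) \<cdot> e"
    using Comp_assoc[OF eM h fM] Comp_assoc[OF eM k fM] eq by simp
  then show ?thesis
    unfolding is_equalizer_def D using fh fk eM univ cancel by (auto simp: hom_def)
qed

lemma A_regular_mono_if_subset_S_hull:
  assumes "\<B> \<subseteq> S_hull C \<A>" "is_A_regular_mono C \<B> e"
  shows "is_A_regular_mono C \<A> e"
proof -
  obtain h k where hk: "Cod C h \<in> \<B>" "is_equalizer C h k e"
    using assms(2) unfolding is_A_regular_mono_def by blast
  obtain A f where f: "A \<in> \<A>" "f \<in> hom C (Cod C h) A" "is_mono C f"
    using assms(1) hk(1) unfolding S_hull_def by blast
  have "is_equalizer C (f \<cdot> h) (f \<cdot> k) e"
    using is_equalizer_mono_Comp[OF hk(2) f(3)] f(2) by (simp add: hom_def)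
  moreover have "Cod C (f \<cdot> h) = A"
    using Comp_in[OF hom_Mor f(2)] hk(2) unfolding is_equalizer_def by (auto simp: hom_def)
  ultimately show ?thesis
    using f(1) unfolding is_A_regular_mono_def by blast
qed

section \<open>Points\<close>

lemma terminal_unique: "is_terminal C T \<Longrightarrow> u \<in> hom C Z T \<Longrightarrow> v \<in> hom C Z T \<Longrightarrow> u = v"
  unfolding is_terminal_def using hom_Obj by blast

text \<open>
  A point is a split monomorphism, with retraction the unique morphism \<open>t\<close> to the terminal object,
  and a split monomorphism \<open>a\<close> with retraction \<open>t\<close> is the equalizer of the identity and \<open>a \<cdot> t\<close>.
\<close>

lemma point_is_equalizer:
  assumes T: "is_terminal C T" and a: "a \<in> hom C T X"
  obtains t where "is_equalizer C (Ident C X) (a \<cdot> t) a"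
proof -
  have X: "X \<in> Obj C" and TO: "T \<in> Obj C"
    using hom_Obj[OF a] by auto
  obtain t where t: "t \<in> hom C X T"
    using T X unfolding is_terminal_def by blast
  have ta: "t \<cdot> a = Ident C T"
    using terminal_unique[OF T Comp_in[OF a t] Ident_in[OF TO]] .
  have I: "Ident C X \<in> hom C X X" and at: "a \<cdot> t \<in> hom C X X"
    using Ident_in[OF X] Comp_in[OF t a] by auto
  have D: "Dom C a = T" "Cod C a = X" "Dom C (Ident C X) = X" "Cod C (Ident C X) = X"
    using a I by (auto simp: hom_def)
  have eq: "Ident C X \<cdot> a = (a \<cdot> t) \<cdot> a"
    using Comp_Ident_left[OF a] Comp_Ident_right[OF a] Comp_assoc[OF a t a] ta by simp
  have "\<exists>!v. v \<in> hom C Z T \<and> a \<cdot> v = u"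
    if u: "u \<in> hom C Z X" and *: "Ident C X \<cdot> u = (a \<cdot> t) \<cdot> u" for Z u
  proof (rule ex1I[of _ "t \<cdot> u"])
    show "t \<cdot> u \<in> hom C Z T \<and> a \<cdot> (t \<cdot> u) = u"
      using Comp_in[OF u t] Comp_assoc[OF u t a] Comp_Ident_left[OF u] * by simp
  next
    fix v assume "v \<in> hom C Z T \<and> a \<cdot> v = u"
    then show "v = t \<cdot> u"
      using terminal_unique[OF T _ Comp_in[OF u t]] by blast
  qed
  then have "is_equalizer C (Ident C X) (a \<cdot> t) a"
    unfolding is_equalizer_def D using I at eq a D by (auto simp: hom_def)
  then show thesis
    using that by blast
qed

lemma point_A_regular_mono:
  assumes "is_terminal C T" "a \<in> hom C T X" "X \<in> \<B>"
  shows "is_A_regular_mono C \<B> a"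
proof -
  obtain t where "is_equalizer C (Ident C X) (a \<cdot> t) a"
    using point_is_equalizer[OF assms(1,2)] .
  moreover have "Cod C (Ident C X) = X"
    using Ident_in hom_Obj[OF assms(2)] by (auto simp: hom_def)
  ultimately show ?thesis
    using assms(3) unfolding is_A_regular_mono_def by metis
qed

lemma point_eq_if_sub_le:
  assumes T: "is_terminal C T" and a: "a \<in> hom C T X" and b: "b \<in> hom C T X"
    and le: "sub_le C b a"
  shows "b = a"
proof -
  obtain k where k: "k \<in> hom C T T" "b = a \<cdot> k"
    using le a b unfolding sub_le_def by (auto simp: hom_def)
  have "k = Ident C T"
    using terminal_unique[OF T k(1)] Ident_in hom_Obj[OF k(1)] by blast
  then show ?thesis
    using k(2) Comp_Ident_right[OF a] by simp
qed

lemma mono_if_inj_on_points: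
  assumes G: "is_generator C G" and f: "f \<in> hom C X Y"
    and inj: "\<And>a b. a \<in> hom C G X \<Longrightarrow> b \<in> hom C G X \<Longrightarrow> f \<cdot> a = f \<cdot> b \<Longrightarrow> a = b"
  shows "is_mono C f"
proof -
  have "u = v" if u: "u \<in> hom C Z X" and v: "v \<in> hom C Z X" and eq: "f \<cdot> u = f \<cdot> v" for Z u v
  proof (rule ccontr)
    assume "u \<noteq> v"
    then obtain x where x: "x \<in> hom C G Z" "u \<cdot> x \<noteq> v \<cdot> x"
      using G u v unfolding is_generator_def by blast
    have "f \<cdot> (u \<cdot> x) = f \<cdot> (v \<cdot> x)"
      using Comp_assoc[OF x(1) u f] Comp_assoc[OF x(1) v f] eq by simp
    then show False
      using inj Comp_in[OF x(1) u] Comp_in[OF x(1) v] x(2) by blast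
  qed
  then show ?thesis
    using f unfolding is_mono_def hom_def by auto
qed

end

section \<open>The regular closure operator\<close>

context M_complete_category
begin

text \<open>
  The diagonal of the multiple pullback of all members of \<open>R\<close> is their meet: its universal property,
  restricted to cones whose diagonal is in \<open>\<M>\<close>, is that of the meet.
\<close>

lemma meet_exists:
  assumes X: "X \<in> Obj C" and R: "R \<subseteq> M_over C \<M> X"
  shows "\<exists>c. is_meet C \<M> X R c"
proof -
  have RM: "\<And>i. i \<in> R \<Longrightarrow> i \<in> \<M> \<and> Cod C i = X"
    using R unfolding M_over_def by auto
  obtain p \<pi> where p: "is_multiple_pullback C X R (\<lambda>i. i) p \<pi>"
    using M_multiple_pullback_ex[OF X, of R "\<lambda>i. i"] RM by blast
  have pM: "p \<in> M_over C \<M> X"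
    using M_multiple_pullback[OF _ p] RM p unfolding M_over_def is_multiple_pullback_def by auto
  have le: "sub_le C p r" if "r \<in> R" for r
    using p that unfolding is_multiple_pullback_def sub_le_def by metis
  have "sub_le C n p" if n: "n \<in> M_over C \<M> X" and low: "\<forall>r\<in>R. sub_le C n r" for n
  proof -
    have nh: "n \<in> hom C (Dom C n) X"
      using n M_Mor unfolding M_over_def hom_def by auto
    obtain \<sigma> where "\<forall>r\<in>R. \<sigma> r \<in> hom C (Dom C n) (Dom C r) \<and> r \<cdot> \<sigma> r = n"
      using low unfolding sub_le_def by metis
    then obtain u where "u \<in> hom C (Dom C n) (Dom C p)" "p \<cdot> u = n"
      using p nh unfolding is_multiple_pullback_def by blast
    then show ?thesis
      unfolding sub_le_def by blast
  qed
  then show ?thesis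
    using pM le unfolding is_meet_def by blast
qed

lemma regular_closure_is_meet:
  assumes "m \<in> \<M>"
  shows "is_meet C \<M> (Cod C m) {r \<in> \<M>. sub_le C m r \<and> is_A_regular_mono C \<A> r}
    (regular_closure C \<M> \<A> m)"
proof -
  have "Cod C r = Cod C m" if "r \<in> \<M>" "sub_le C m r" for r
  proof -
    obtain k where k: "k \<in> hom C (Dom C m) (Dom C r)" "m = r \<cdot> k"
      using \<open>sub_le C m r\<close> unfolding sub_le_def by blast
    have "r \<in> hom C (Dom C r) (Cod C r)"
      using \<open>r \<in> \<M>\<close> M_Mor hom_Mor by blast
    then show ?thesis
      using Comp_in[OF k(1)] k(2) by (simp add: hom_def)
  qed
  then have "{r \<in> \<M>. sub_le C m r \<and> is_A_regular_mono C \<A> r} \<subseteq> M_over C \<M> (Cod C m)"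
    unfolding M_over_def by auto
  moreover have "Cod C m \<in> Obj C"
    using assms M_Mor Cod_in by blast
  ultimately have "\<exists>c. is_meet C \<M> (Cod C m) {r \<in> \<M>. sub_le C m r \<and> is_A_regular_mono C \<A> r} c"
    using meet_exists by blast
  then show ?thesis
    unfolding regular_closure_def by (rule someI_ex)
qed

lemma regular_closure_Mor: "m \<in> \<M> \<Longrightarrow> regular_closure C \<M> \<A> m \<in> Mor C"
  using regular_closure_is_meet[of m \<A>] M_Mor unfolding is_meet_def M_over_def by blast

lemma same_regular_closure_if_subset_S_hull:
  assumes "\<B> \<subseteq> S_hull C \<A>" "\<A> \<subseteq> S_hull C \<B>"
  shows "same_regular_closure C \<M> \<A> \<B>"
proof -
  have "is_A_regular_mono C \<A> = is_A_regular_mono C \<B>"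
    using A_regular_mono_if_subset_S_hull assms by blast
  then have "regular_closure C \<M> \<A> = regular_closure C \<M> \<B>"
    unfolding regular_closure_def by presburger
  then show ?thesis
    unfolding same_regular_closure_def sub_equiv_def
    using sub_le_refl regular_closure_Mor by simp
qed

text \<open>
  A morphism from \<open>X\<close> to \<open>\<A>\<close> factors through \<open>\<rho>\<close> and so cannot tell apart what \<open>\<rho>\<close> identifies.
  Hence an equalizer of two such morphisms that contains \<open>a\<close> also contains \<open>b\<close>.
\<close>

lemma point_le_closure:
  assumes a: "a \<in> hom C T X" "a \<in> \<M>" and b: "b \<in> hom C T X" "b \<in> \<M>"
    and \<rho>: "\<rho> \<in> hom C X R" "\<rho> \<cdot> a = \<rho> \<cdot> b"
    and fac: "\<And>A f. A \<in> \<A> \<Longrightarrow> f \<in> hom C X A \<Longrightarrow> \<exists>g \<in> hom C R A. g \<cdot> \<rho> = f"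
  shows "sub_le C b (regular_closure C \<M> \<A> a)"
proof -
  have collapse: "f \<cdot> a = f \<cdot> b" if f: "A \<in> \<A>" "f \<in> hom C X A" for A f
  proof -
    obtain g where g: "g \<in> hom C R A" "g \<cdot> \<rho> = f"
      using fac[OF f] by blast
    show ?thesis
      using Comp_assoc[OF a(1) \<rho>(1) g(1)] Comp_assoc[OF b(1) \<rho>(1) g(1)] g(2) \<rho>(2) by simp
  qed
  have "sub_le C b r" if r: "sub_le C a r" "is_A_regular_mono C \<A> r" for r
  proof -
    obtain h k where hk: "Cod C h \<in> \<A>" "is_equalizer C h k r"
      using r(2) unfolding is_A_regular_mono_def by blast
    let ?Y = "Dom C h" and ?A = "Cod C h"
    have h: "h \<in> hom C ?Y ?A" and k: "k \<in> hom C ?Y ?A" and rh: "r \<in> hom C (Dom C r) ?Y"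
      and eq: "h \<cdot> r = k \<cdot> r"
      using hk(2) unfolding is_equalizer_def hom_def by auto
    obtain j where j: "j \<in> hom C T (Dom C r)" "a = r \<cdot> j"
      using r(1) a(1) unfolding sub_le_def by (auto simp: hom_def)
    have Y: "?Y = X"
      using Comp_in[OF j(1) rh] j(2) a(1) by (simp add: hom_def)
    have "h \<cdot> a = k \<cdot> a"
      using Comp_assoc[OF j(1) rh h] Comp_assoc[OF j(1) rh k] eq j(2) by simp
    then have "h \<cdot> b = k \<cdot> b"
      using collapse[OF hk(1)] h k unfolding Y by metis
    then show ?thesis
      using sub_le_if_equalizes[OF hk(2)] b(1) Y by (auto simp: hom_def)
  qed
  moreover have "b \<in> M_over C \<M> (Cod C a)"
    using a(1) b unfolding M_over_def by (auto simp: hom_def)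
  ultimately show ?thesis
    using regular_closure_is_meet[OF a(2), of \<A>] unfolding is_meet_def by blast
qed

end

section \<open>Reflections and the closure of points\<close>

context regular_closure_setting
begin

lemma point_in_M: "is_terminal C T \<Longrightarrow> a \<in> hom C T X \<Longrightarrow> a \<in> \<M>"
  using M_regular_mono point_is_equalizer unfolding is_regular_mono_def by metis

lemma subset_S_hull_if_same_regular_closure:
  assumes T: "is_terminal C T" "is_generator C T"
    and \<A>: "reflective_subcategory C \<A>" and \<B>: "\<B> \<subseteq> Obj C"
    and closure_le: "\<And>m. m \<in> \<M> \<Longrightarrow>
      sub_le C (regular_closure C \<M> \<A> m) (regular_closure C \<M> \<B> m)"
  shows "\<B> \<subseteq> S_hull C \<A>"
proof
  fix B assume B: "B \<in> \<B>"
  then have BO: "B \<in> Obj C"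
    using \<B> by blast
  obtain R \<rho> where R: "R \<in> \<A>" and \<rho>: "\<rho> \<in> hom C B R"
    and fac: "\<And>A f. A \<in> \<A> \<Longrightarrow> f \<in> hom C B A \<Longrightarrow> \<exists>g \<in> hom C R A. g \<cdot> \<rho> = f"
    using \<A> BO unfolding reflective_subcategory_def by metis
  have "is_mono C \<rho>"
  proof (rule mono_if_inj_on_points[OF T(2) \<rho>])
    fix a b assume a: "a \<in> hom C T B" and b: "b \<in> hom C T B" and eq: "\<rho> \<cdot> a = \<rho> \<cdot> b"
    have aM: "a \<in> \<M>" and bM: "b \<in> \<M>"
      using point_in_M[OF T(1)] a b by auto
    have a_Mor: "a \<in> Mor C"
      using a by (simp add: hom_def)
    have "sub_le C b (regular_closure C \<M> \<A> a)"
      using point_le_closure[OF a aM b bM \<rho> eq fac] .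
    moreover have "sub_le C (regular_closure C \<M> \<B> a) a"
      using regular_closure_is_meet[OF aM, of \<B>] aM sub_le_refl[OF a_Mor]
        point_A_regular_mono[OF T(1) a B]
      unfolding is_meet_def by blast
    ultimately have "sub_le C b a"
      using closure_le[OF aM] sub_le_trans regular_closure_Mor[OF aM] a_Mor by blast
    then show "a = b"
      using point_eq_if_sub_le[OF T(1) a b] by simp
  qed
  then show "B \<in> S_hull C \<A>"
    using BO R \<rho> unfolding S_hull_def by blast
qed

end

theorem corollary4p2:
  fixes \<X> :: "('o, 'm) cat" and \<M> :: "'m set" and T :: 'o and \<A> \<B> :: "'o set"
  assumes "regular_closure_setting \<X> \<M>"
    and "is_terminal \<X> T" and "is_generator \<X> T"
    and "reflective_subcategory \<X> \<A>" and "reflective_subcategory \<X> \<B>"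
  shows "(same_regular_closure \<X> \<M> \<A> \<B> \<longleftrightarrow> \<B> \<subseteq> S_hull \<X> \<A> \<and> \<A> \<subseteq> S_hull \<X> \<B>) \<and>
    (\<A> \<subseteq> \<B> \<longrightarrow> (same_regular_closure \<X> \<M> \<A> \<B> \<longleftrightarrow> \<B> \<subseteq> S_hull \<X> \<A>))"
proof -
  interpret regular_closure_setting \<X> \<M>
    by (rule assms(1))
  have \<A>: "\<A> \<subseteq> Obj \<X>" and \<B>: "\<B> \<subseteq> Obj \<X>"
    using assms(4,5) unfolding reflective_subcategory_def subcategory_def by auto
  have iff: "same_regular_closure \<X> \<M> \<A> \<B> \<longleftrightarrow> \<B> \<subseteq> S_hull \<X> \<A> \<and> \<A> \<subseteq> S_hull \<X> \<B>"
  proof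
    assume "same_regular_closure \<X> \<M> \<A> \<B>"
    then have "sub_le \<X> (regular_closure \<X> \<M> \<A> m) (regular_closure \<X> \<M> \<B> m)"
      and "sub_le \<X> (regular_closure \<X> \<M> \<B> m) (regular_closure \<X> \<M> \<A> m)" if "m \<in> \<M>" for m
      using that unfolding same_regular_closure_def sub_equiv_def by auto
    then show "\<B> \<subseteq> S_hull \<X> \<A> \<and> \<A> \<subseteq> S_hull \<X> \<B>"
      using subset_S_hull_if_same_regular_closure[OF assms(2,3,4) \<B>]
        subset_S_hull_if_same_regular_closure[OF assms(2,3,5) \<A>] by blast
  next
    assume "\<B> \<subseteq> S_hull \<X> \<A> \<and> \<A> \<subseteq> S_hull \<X> \<B>"
    then show "same_regular_closure \<X> \<M> \<A> \<B>"
      using same_regular_closure_if_subset_S_hull by blast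
  qed
  moreover have "\<A> \<subseteq> S_hull \<X> \<B>" if "\<A> \<subseteq> \<B>"
    using subset_S_hull[OF that \<B>] .
  ultimately show ?thesis
    by blast
qed

end
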